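(* Let $A \in \mathbb{M}_{n\times n}(\mathbb{R})$, $B \in \mathbb{M}_{n\times m}(\mathbb{R})$ with $(A,B)$ stabilizable, and let $Q=Q^\top$, $R=R^\top$ (not necessarily positive semidefinite). Assume that $f$ (defined in the context) has a strict local minimizer over $\mathcal S$, i.e., there exist $K_*\in\mathcal S$ and $\delta>0$ with $f(K_* )<f(K)$ for all $K\in\mathcal S$ with $0<\|K-K_*\|_F<\delta$. Let $K_0 \in \mathcal S$ and consider the natural gradient iterates $$K_{j+1} = K_j - \eta_j\, \mathbf{n}(K_j), \qquad \mathbf n(K) = 2\big(RK - B^\top X_K (A-BK)\big),$$ with stepsize $\eta_j = 1/\big(2\lambda_n(R + B^\top X_{K_j} B)\big)$, where $\lambda_n$ denotes the largest eigenvalue. Then all iterates lie in $\mathcal S$, and both the function values and the gains converge to their global minima at a linear rate: there exist $q_1 \in (0,1)$ and $c_1>0$ such that for all $j$, $$f(K_j) - f(K_* ) \le q_1^j\,(f(K_0)-f(K_* )), \qquad \|K_j - K_*\|_F^2 \le c_1 q_1^j \|K_0-K_*\|_F^2.$$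
   Context: $\mathcal S = \{K \in \mathbb{M}_{m\times n}(\mathbb{R}) : \rho(A-BK)<1\}$, $\rho$ the spectral radius. Fix a spanning set $\{z_1,\dots,z_n\}$ of $\mathbb{R}^n$ and let $\Sigma=\sum_i z_iz_i^\top$. For $K\in\mathcal S$, $X_K$ is the unique solution of $(A-BK)^\top X(A-BK)+Q+K^\top RK = X$, and $f(K)=\mathrm{Tr}(X_K\Sigma)$. Under the assumption, $K_*$ is the unique global minimizer of $f$ over $\mathcal S$. *)

theory Defs
  imports "HOL-Analysis.Analysis"
begin

definition cmat :: "real^'n^'n \<Rightarrow> complex^'n^'n" where
  "cmat M = (\<chi> i j. complex_of_real (M $ i $ j))"

definition spec_rad :: "real^'n^'n \<Rightarrow> real" where
  "spec_rad M = Sup (cmod ` {lam. \<exists>v::complex^'n. v \<noteq> 0 \<and> cmat M *v v = lam *s v})"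

definition lam_max :: "real^'n^'n \<Rightarrow> real" where
  "lam_max M = Max {lam. \<exists>v::real^'n. v \<noteq> 0 \<and> M *v v = lam *s v}"

definition stab_set :: "real^'n^'n \<Rightarrow> real^'m^'n \<Rightarrow> (real^'n^'m) set" where
  "stab_set A B = {K. spec_rad (A - B ** K) < 1}"

definition XK :: "real^'n^'n \<Rightarrow> real^'m^'n \<Rightarrow> real^'n^'n \<Rightarrow> real^'m^'m \<Rightarrow> real^'n^'m \<Rightarrow> real^'n^'n" where
  "XK A B Q R K = (THE X. transpose (A - B ** K) ** X ** (A - B ** K) + Q + transpose K ** R ** K = X)"

definition Sigma_mat :: "('n \<Rightarrow> real^'n) \<Rightarrow> real^'n^'n" where
  "Sigma_mat z = (\<Sum>i\<in>UNIV. (\<chi> a b. z i $ a * z i $ b))"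

definition LQR_cost :: "real^'n^'n \<Rightarrow> real^'m^'n \<Rightarrow> real^'n^'n \<Rightarrow> real^'m^'m \<Rightarrow> ('n \<Rightarrow> real^'n) \<Rightarrow> real^'n^'m \<Rightarrow> real" where
  "LQR_cost A B Q R z K = trace (XK A B Q R K ** Sigma_mat z)"

definition nat_grad :: "real^'n^'n \<Rightarrow> real^'m^'n \<Rightarrow> real^'n^'n \<Rightarrow> real^'m^'m \<Rightarrow> real^'n^'m \<Rightarrow> real^'n^'m" where
  "nat_grad A B Q R K = 2 *\<^sub>R (R ** K - transpose B ** XK A B Q R K ** (A - B ** K))"

definition frob :: "real^'c^'r \<Rightarrow> real" where
  "frob M = sqrt (\<Sum>i\<in>UNIV. \<Sum>j\<in>UNIV. (M $ i $ j)^2)"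

end

theory Submission
  imports Defs "HOL-Computational_Algebra.Fundamental_Theorem_Algebra"
begin

text \<open>Everything is phrased with quadratic forms. If \<open>A\<close> is stable and \<open>D\<close> satisfies
  \<open>qform D (A x) \<le> qform D x\<close> for all \<open>x\<close>, then \<open>qform D \<ge> 0\<close>, because \<open>qform D (A\<^sup>k x) \<rightarrow> 0\<close>.
  Put \<open>M K = R K - B\<^sup>T X\<^sub>K (A - B K)\<close> and \<open>W K = R + B\<^sup>T X\<^sub>K B\<close>. For two stabilizing gains, the
  decay of \<open>D = X\<^sub>K' - X\<^sub>K\<close> along the closed loop of \<open>K'\<close> is
  \<open>qform (W K) (\<Delta> x) + 2 \<Delta> x \<bullet> M K x\<close> with \<open>\<Delta> = K' - K\<close>. Testing a strict local minimizer \<open>K\<^sub>*\<close>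
  along rays gives \<open>M K\<^sub>* = 0\<close> and \<open>W K\<^sub>* \<ge> \<mu> > 0\<close>, hence \<open>X\<^sub>K \<ge> X\<^sub>*\<close> and \<open>W K \<ge> \<mu>\<close> for every
  stabilizing \<open>K\<close>. A natural gradient step lowers \<open>X\<^sub>K\<close> by at least \<open>\<parallel>M K x\<parallel>\<^sup>2 / \<lambda>\<^sub>n(W K)\<close>; the new
  gain is stabilizing since \<open>X\<^sub>K - X\<^sub>*\<close> is a Lyapunov function whose decay vanishes only where the
  new closed loop agrees with the optimal one. Together with the gradient domination
  \<open>f(K) - f(K\<^sub>*) \<le> const \<cdot> \<parallel>M K\<parallel>\<^sup>2\<close> this yields the linear rate, and quadratic growth
  \<open>f(K) - f(K\<^sub>*) \<ge> const \<cdot> \<parallel>K - K\<^sub>*\<parallel>\<^sup>2\<close> transfers it to the gains.\<close>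

section \<open>Powers of matrices with spectrum in the open unit disk\<close>

text \<open>This is \<open>p(M) w\<close> by Horner's rule; acting on a vector lets identities be
  proved by induction on \<open>p\<close>.\<close>

definition poly_mv :: "complex^'n^'n \<Rightarrow> complex poly \<Rightarrow> complex^'n \<Rightarrow> complex^'n" where
  "poly_mv M p w = fold_coeffs (\<lambda>a v. a *s w + M *v v) p 0"

lemma poly_mv_0 [simp]: "poly_mv M 0 w = 0"
  by (simp add: poly_mv_def)

lemma poly_mv_pCons [simp]: "poly_mv M (pCons a p) w = a *s w + M *v poly_mv M p w"
  by (cases "p = 0 \<and> a = 0") (auto simp: poly_mv_def)

lemma poly_mv_add: "poly_mv M (p + q) w = poly_mv M p w + poly_mv M q w"
  by (induction p q rule: poly_induct2) (simp_all add: algebra_simps vector_sadd_rdistrib)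

lemma poly_mv_sum: "poly_mv M (\<Sum>i\<in>I. f i) w = (\<Sum>i\<in>I. poly_mv M (f i) w)"
  by (induction I rule: infinite_finite_induct) (simp_all add: poly_mv_add)

lemma poly_mv_monom: "poly_mv M (monom c k) w = c *s (((*v) M ^^ k) w)"
proof (induction k)
  case (Suc k)
  then show ?case
    by (simp add: monom_Suc matrix_vector_mult_def vec_eq_iff sum_distrib_left mult_ac)
qed (simp add: monom_0)

lemma poly_mv_diff_right: "poly_mv M p (v - w) = poly_mv M p v - poly_mv M p w"
  by (induction p) (simp_all add: matrix_vector_mult_diff_distrib vector_ssub_ldistrib)

lemma poly_mv_scale_right: "poly_mv M p (c *s w) = c *s poly_mv M p w"
  by (induction p) (simp_all add: vector_add_ldistrib vector_scalar_commute mult_ac)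

lemma poly_mv_commute: "poly_mv M p (M *v w) = M *v poly_mv M p w"
  by (induction p) (simp_all add: vector_scalar_commute matrix_vector_right_distrib)

lemma poly_mv_smult: "poly_mv M (smult c p) w = c *s poly_mv M p w"
  by (induction p) (simp_all add: vector_add_ldistrib vector_scalar_commute)

lemma poly_mv_linear_factor:
  "poly_mv M ([:-r, 1:] * q) w = M *v poly_mv M q w - r *s poly_mv M q w"
proof -
  have "[:-r, 1:] * q = pCons 0 q + smult (- r) q"
    by (simp add: mult_pCons_left)
  then show ?thesis
    by (simp only: poly_mv_add poly_mv_smult) simp
qed

lemma poly_mv_eigenvector:
  assumes "M *v v = lam *s v"
  shows "poly_mv M p v = poly p lam *s v"
  by (induction p) (simp_all add: assms vector_scalar_commute vector_sadd_rdistrib mult_ac)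

text \<open>The \<open>N + 1\<close> powers \<open>P 0\<close>, ..., \<open>P N\<close> lie in a
  real space of dimension \<open>N\<close>, so they satisfy a nontrivial real linear relation, whose
  coefficients form \<open>p\<close>.\<close>

lemma ex_annihilating_poly:
  fixes M :: "complex^'n^'n"
  obtains p where "p \<noteq> 0" "\<And>w. poly_mv M p w = 0"
proof -
  define P where "P k = ((**) M ^^ k) (mat 1)" for k
  define N where "N = DIM(complex^'n^'n)"
  have P_mv: "P k *v w = ((*v) M ^^ k) w" for k w
    by (induction k) (simp_all add: P_def matrix_vector_mul_assoc [symmetric])
  have "\<exists>c::nat \<Rightarrow> real. (\<exists>i\<le>N. c i \<noteq> 0) \<and> (\<Sum>i\<le>N. c i *\<^sub>R P i) = 0"
  proof (cases "inj_on P {..N}")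
    case True
    have "card (P ` {..N}) > N"
      using True by (simp add: card_image)
    then have "dependent (P ` {..N})"
      using independent_bound [of "P ` {..N}"] by (auto simp: N_def)
    then obtain u where u: "\<exists>v\<in>P ` {..N}. u v \<noteq> 0" "(\<Sum>v\<in>P ` {..N}. u v *\<^sub>R v) = 0"
      by (subst (asm) dependent_finite) auto
    then show ?thesis
      using True by (intro exI [of _ "u \<circ> P"]) (auto simp: sum.reindex)
  next
    case False
    \<comment> \<open>Coinciding powers shrink the image below the dimension bound, but give the
      relation \<open>P i - P j = 0\<close> directly.\<close>
    then obtain i j where ij: "i \<le> N" "j \<le> N" "i \<noteq> j" "P i = P j"
      by (auto simp: inj_on_def)
    have "(\<Sum>k\<le>N. (if k = i then 1 else if k = j then - 1 else 0) *\<^sub>R P k)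
        = (\<Sum>k\<le>N. (if k = i then P k else 0) - (if k = j then P k else 0))"
      using ij by (intro sum.cong) auto
    also have "\<dots> = 0"
      using ij by (simp add: sum_subtractf)
    finally show ?thesis
      using ij by (intro exI [of _ "\<lambda>k. if k = i then 1 else if k = j then - 1 else 0"]) auto
  qed
  then obtain c i where c: "i \<le> N" "c i \<noteq> 0" "(\<Sum>i\<le>N. c i *\<^sub>R P i) = 0"
    by blast
  define p where "p = (\<Sum>i\<le>N. monom (complex_of_real (c i)) i)"
  have "coeff p i = complex_of_real (c i)"
    using c(1) by (simp add: p_def coeff_sum)
  then have "p \<noteq> 0"
    using c(2) by auto
  moreover have "poly_mv M p w = 0" for w
  proof -
    have "poly_mv M p w = (\<Sum>i\<le>N. complex_of_real (c i) *s (P i *v w))"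
      by (simp add: p_def poly_mv_sum poly_mv_monom P_mv)
    also have "\<dots> = (\<Sum>i\<le>N. c i *\<^sub>R P i) *v w"
      by (simp add: vec_eq_iff matrix_vector_mult_def sum_distrib_left sum_distrib_right
          scaleR_conv_of_real [where 'a = complex] mult_ac sum.swap [of _ "{..N}"])
    finally show ?thesis
      using c(3) by simp
  qed
  ultimately show thesis
    using that by blast
qed

definition spectrum :: "complex^'n^'n \<Rightarrow> complex set" where
  "spectrum M = {lam. \<exists>v. v \<noteq> 0 \<and> M *v v = lam *s v}"

lemma spectrumI: "M *v v = lam *s v \<Longrightarrow> v \<noteq> 0 \<Longrightarrow> lam \<in> spectrum M"
  by (auto simp: spectrum_def)

lemma finite_spectrum: "finite (spectrum M)"
proof -
  obtain p where p: "p \<noteq> 0" "\<And>w. poly_mv M p w = 0"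
    using ex_annihilating_poly by blast
  have "spectrum M \<subseteq> {x. poly p x = 0}"
    using poly_mv_eigenvector [of M _ _ p] p(2) by (fastforce simp: spectrum_def)
  then show ?thesis
    using poly_roots_finite [OF p(1)] finite_subset by blast
qed

text \<open>Strong induction on annihilating polynomials: each linear factor is either invertible or
  belongs to an eigenvalue.\<close>

lemma annihilated_cases:
  fixes M :: "complex^'n^'n"
  assumes "p \<noteq> 0" "poly_mv M p w = 0" "w \<noteq> 0"
  obtains lam q where "lam \<in> spectrum M" "q \<noteq> 0" "degree q < degree p"
    "poly_mv M q (M *v w - lam *s w) = 0"
  using assms
proof (induction "degree p" arbitrary: p thesis rule: less_induct)
  case less
  have "degree p \<noteq> 0"
  proof
    assume "degree p = 0"
    then obtain c where "p = [:c:]"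
      by (rule degree_eq_zeroE)
    with less.prems show False
      by simp
  qed
  then obtain r where r: "poly p r = 0"
    using fundamental_theorem_of_algebra [of p] constant_degree [of p] by auto
  then obtain q where q: "p = [:-r, 1:] * q"
    by (meson poly_eq_0_iff_dvd dvdE)
  have "q \<noteq> 0"
    using q less.prems by auto
  then have deg: "degree q < degree p"
    using degree_mult_eq [of "[:-r, 1:]" q] q by simp
  have fac: "M *v poly_mv M q w = r *s poly_mv M q w"
    using less.prems(3) by (simp only: q poly_mv_linear_factor right_minus_eq)
  show ?case
  proof (cases "poly_mv M q w = 0")
    case True
    obtain lam q' where "lam \<in> spectrum M" "q' \<noteq> 0" "degree q' < degree q"
      "poly_mv M q' (M *v w - lam *s w) = 0"
      using less.hyps [OF deg _ \<open>q \<noteq> 0\<close> True less.prems(4)] by blast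
    then show ?thesis
      using less.prems(1) deg by (meson less_trans)
  next
    case False
    \<comment> \<open>Here \<open>q(M) w\<close> is an eigenvector for \<open>r\<close>, and
      \<open>q(M)\<close> commutes with \<open>M\<close>, so \<open>q\<close> annihilates
      \<open>M w - r w\<close>.\<close>
    have "poly_mv M q (M *v w - r *s w) = 0"
      using fac by (simp add: poly_mv_diff_right poly_mv_commute poly_mv_scale_right)
    then show ?thesis
      using less.prems(1) spectrumI [OF fac False] \<open>q \<noteq> 0\<close> deg by blast
  qed
qed

lemma spectrum_nonempty: "spectrum M \<noteq> {}"
proof -
  obtain p where p: "p \<noteq> 0" "\<And>w. poly_mv M p w = 0"
    using ex_annihilating_poly by blast
  have "axis undefined 1 \<noteq> (0 :: complex^'n)"
    by (simp add: axis_eq_0_iff)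
  then show ?thesis
    using annihilated_cases [OF p(1) p(2)] by blast
qed

text \<open>A finite nonempty spectrum turns the supremum into a maximum, so the strict bound can be
  tested on each eigenvalue.\<close>

lemma spec_rad_less_1_iff: "spec_rad A < 1 \<longleftrightarrow> (\<forall>lam\<in>spectrum (cmat A). cmod lam < 1)"
proof -
  have "spec_rad A = Max (cmod ` spectrum (cmat A))"
    unfolding spec_rad_def spectrum_def [symmetric]
    by (simp add: cSup_eq_Max finite_spectrum spectrum_nonempty)
  then show ?thesis
    by (simp add: finite_spectrum spectrum_nonempty)
qed

lemma funpow_mv_diff:
  fixes M :: "'a::ring_1^'n^'n"
  shows "((*v) M ^^ k) (v - w) = ((*v) M ^^ k) v - ((*v) M ^^ k) w"
  by (induction k) (simp_all add: matrix_vector_mult_diff_distrib)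

lemma funpow_mv_scale:
  fixes M :: "'a::field^'n^'n"
  shows "((*v) M ^^ k) (c *s w) = c *s ((*v) M ^^ k) w"
  by (induction k) (simp_all add: vector_scalar_commute)

lemma norm_scale_complex: "norm (c *s (w::complex^'n)) = cmod c * norm w"
  by (simp add: norm_vec_def L2_set_def norm_mult power_mult_distrib sum_distrib_left [symmetric]
      real_sqrt_mult)

text \<open>Summing the recursion gives \<open>S \<le> a 0 + r * S + suminf b\<close> for each
  partial sum \<open>S\<close> of \<open>a\<close>, which bounds \<open>S\<close>.\<close>

lemma summable_of_contraction:
  fixes a b :: "nat \<Rightarrow> real"
  assumes "\<And>k. 0 \<le> a k" "\<And>k. 0 \<le> b k" "r < 1" "0 \<le> r" "summable b"
    and le: "\<And>k. a (Suc k) \<le> r * a k + b k"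
  shows "summable a"
proof (rule summableI_nonneg_bounded)
  fix n
  have "sum a {..<n} \<le> a 0 + (\<Sum>k<n. a (Suc k))"
    using sum.lessThan_Suc_shift [of a n] sum.lessThan_Suc [of a n] assms(1) [of n] by linarith
  also have "(\<Sum>k<n. a (Suc k)) \<le> r * sum a {..<n} + sum b {..<n}"
    using sum_mono [OF le] by (simp add: sum.distrib sum_distrib_left)
  also have "sum b {..<n} \<le> suminf b"
    using assms by (intro sum_le_suminf) auto
  finally have "(1 - r) * sum a {..<n} \<le> a 0 + suminf b"
    by (simp add: algebra_simps)
  then show "sum a {..<n} \<le> (a 0 + suminf b) / (1 - r)"
    using \<open>r < 1\<close> by (simp add: field_simps)
qed (use assms in auto)

text \<open>Induction on the degree of a polynomial annihilating \<open>w\<close>: the orbit of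
  \<open>M w - lam w\<close> is summable by induction, and it drives a contraction with factor
  \<open>cmod lam\<close> for the orbit of \<open>w\<close>. No Jordan form is involved.\<close>

lemma summable_funpow_mv:
  fixes M :: "complex^'n^'n"
  assumes "\<And>lam. lam \<in> spectrum M \<Longrightarrow> cmod lam < 1"
  shows "summable (\<lambda>k. norm (((*v) M ^^ k) w))"
proof -
  obtain p where p: "p \<noteq> 0" "\<And>w. poly_mv M p w = 0"
    using ex_annihilating_poly by blast
  from p(1) p(2) [of w] show ?thesis
  proof (induction "degree p" arbitrary: p w rule: less_induct)
    case less
    show ?case
    proof (cases "w = 0")
      case True
      have "((*v) M ^^ k) 0 = 0" for k
        by (induction k) auto
      then show ?thesis
        using True by simp
    next
      case False
      obtain lam q where lam: "lam \<in> spectrum M" and q: "q \<noteq> 0" "degree q < degree p"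
        "poly_mv M q (M *v w - lam *s w) = 0"
        using annihilated_cases [OF less.prems False] by blast
      let ?w = "M *v w - lam *s w"
      have sm: "summable (\<lambda>k. norm (((*v) M ^^ k) ?w))"
        using less.hyps q by blast
      have eq: "((*v) M ^^ Suc k) w = lam *s ((*v) M ^^ k) w + ((*v) M ^^ k) ?w" for k
        by (simp add: funpow_mv_diff funpow_mv_scale funpow_swap1)
      show ?thesis
      proof (rule summable_of_contraction [OF _ _ _ _ sm])
        show "norm (((*v) M ^^ Suc k) w) \<le> cmod lam * norm (((*v) M ^^ k) w) + norm (((*v) M ^^ k) ?w)"
          for k
          unfolding eq using norm_triangle_ineq norm_scale_complex by metis
      qed (use assms [OF lam] in auto)
    qed
  qed
qed

definition cvec :: "real^'n \<Rightarrow> complex^'n" where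
  "cvec x = (\<chi> i. complex_of_real (x $ i))"

lemma cmat_mult_cvec: "cmat A *v cvec x = cvec (A *v x)"
  by (simp add: vec_eq_iff cmat_def cvec_def matrix_vector_mult_def)

lemma norm_cvec [simp]: "norm (cvec x) = norm x"
  by (simp add: norm_vec_def L2_set_def cvec_def)

lemma funpow_mv_tendsto_0:
  fixes A :: "real^'n^'n"
  assumes "spec_rad A < 1"
  shows "(\<lambda>k. ((*v) A ^^ k) x) \<longlonglongrightarrow> 0"
proof -
  have "((*v) (cmat A) ^^ k) (cvec x) = cvec (((*v) A ^^ k) x)" for k
    by (induction k) (simp_all add: cmat_mult_cvec)
  then have "summable (\<lambda>k. norm (((*v) A ^^ k) x))"
    using summable_funpow_mv [of "cmat A" "cvec x"] assms by (simp add: spec_rad_less_1_iff)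
  then show ?thesis
    using summable_LIMSEQ_zero tendsto_norm_zero_iff by blast
qed

section \<open>Quadratic forms and the Stein equation\<close>

text \<open>The norm of a matrix here is the Frobenius norm, so Cauchy-Schwarz in each row
  suffices.\<close>

lemma norm_matrix_vector_le:
  fixes M :: "real^'n^'m"
  shows "norm (M *v x) \<le> norm M * norm x"
proof -
  have "norm (M *v x) = L2_set (\<lambda>i. \<bar>M $ i \<bullet> x\<bar>) UNIV"
    by (simp add: norm_vec_def matrix_vector_mul_component)
  also have "\<dots> \<le> L2_set (\<lambda>i. norm (M $ i) * norm x) UNIV"
    by (intro L2_set_mono Cauchy_Schwarz_ineq2) auto
  also have "\<dots> = norm M * norm x"
    by (simp add: norm_vec_def L2_set_left_distrib)
  finally show ?thesis .
qed

lemma frob_eq_norm: "frob M = norm M"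
  by (simp add: frob_def norm_vec_def L2_set_def sum_nonneg)

lemma inner_vector_matrix:
  fixes A :: "real^'n^'m"
  shows "x \<bullet> (w v* A) = (A *v x) \<bullet> w"
  by (metis dot_lmul_matrix inner_commute)

definition qform :: "real^'n^'n \<Rightarrow> real^'n \<Rightarrow> real" where
  "qform X x = x \<bullet> (X *v x)"

lemma qform_add: "qform (X + Y) x = qform X x + qform Y x"
  by (simp add: qform_def inner_add_right algebra_simps)

lemma qform_diff: "qform (X - Y) x = qform X x - qform Y x"
  by (simp add: qform_def inner_diff_right algebra_simps)

lemma qform_minus: "qform (- X) x = - qform X x"
  using qform_diff [of 0 X x] by (simp add: qform_def)

lemma qform_scaleR: "qform (c *\<^sub>R X) x = c * qform X x"
  by (simp add: qform_def scaleR_matrix_vector_assoc [symmetric])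

lemma qform_scaleR_right: "qform X (c *\<^sub>R x) = c\<^sup>2 * qform X x"
  by (simp add: qform_def matrix_vector_mult_scaleR power2_eq_square)

lemma qform_mat_1: "qform (mat 1) x = (norm x)\<^sup>2"
  by (simp add: qform_def power2_norm_eq_inner)

lemma qform_congruence: "qform (transpose C ** X ** C) x = qform X (C *v x)"
  by (simp add: qform_def matrix_vector_mul_assoc [symmetric] inner_vector_matrix)

lemma qform_upper: "qform X x \<le> norm X * (norm x)\<^sup>2"
proof -
  have "qform X x \<le> norm x * norm (X *v x)"
    unfolding qform_def using Cauchy_Schwarz_ineq2 [of x "X *v x"] by linarith
  also have "\<dots> \<le> norm x * (norm X * norm x)"
    by (intro mult_left_mono norm_matrix_vector_le) auto
  finally show ?thesis
    by (simp add: power2_eq_square mult_ac)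
qed

lemma symmetric_inner_commute:
  fixes X :: "real^'n^'n"
  assumes "transpose X = X"
  shows "x \<bullet> (X *v y) = y \<bullet> (X *v x)"
  using inner_vector_matrix [of x y X] assms
  by (metis inner_commute transpose_matrix_vector)

lemma qform_plus:
  assumes "transpose X = X"
  shows "qform X (x + y) = qform X x + 2 * (x \<bullet> (X *v y)) + qform X y"
  using symmetric_inner_commute [OF assms, of x y]
  by (simp add: qform_def inner_add_right inner_add_left matrix_vector_right_distrib)

lemma qform_continuous: "continuous_on S (qform X)"
  unfolding qform_def by (intro continuous_intros matrix_vector_mult_linear_continuous_on)

text \<open>Moving from \<open>v\<close> by \<open>- t\<close> times \<open>N v\<close> changes the
  form by \<open>- 2 t\<close> times the squared norm of \<open>N v\<close>, up to order
  \<open>t\<close> squared; for small \<open>t\<close> this would be negative unless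
  \<open>N v = 0\<close>.\<close>

lemma psd_kernel:
  assumes sym: "transpose N = N" and psd: "\<And>x. 0 \<le> qform N x" and "qform N v = 0"
  shows "N *v v = 0"
proof -
  let ?u = "N *v v"
  have quad: "0 \<le> - 2 * t * (norm ?u)\<^sup>2 + t\<^sup>2 * qform N ?u" for t
  proof -
    have "qform N (v + (- t) *\<^sub>R ?u) = - 2 * t * (norm ?u)\<^sup>2 + t\<^sup>2 * qform N ?u"
      using assms(3) symmetric_inner_commute [OF sym, of v ?u]
      by (simp only: qform_plus [OF sym] qform_scaleR_right matrix_vector_mult_scaleR
          inner_scaleR_right power2_norm_eq_inner) simp
    then show ?thesis
      using psd by metis
  qed
  \<comment> \<open>With \<open>t = 1 / ?c\<close> the quadratic term is at most half the linear
    one; the \<open>1\<close> keeps \<open>?c\<close> positive.\<close>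
  let ?c = "norm N + 1"
  have "?c > 0"
    using norm_ge_zero [of N] by linarith
  have "0 \<le> - 2 * (1 / ?c) * (norm ?u)\<^sup>2 + (1 / ?c)\<^sup>2 * (norm N * (norm ?u)\<^sup>2)"
    using quad [of "1 / ?c"] mult_left_mono [OF qform_upper [of N ?u], of "(1 / ?c)\<^sup>2"] by simp
  also have "\<dots> \<le> - 2 * (1 / ?c) * (norm ?u)\<^sup>2 + (1 / ?c)\<^sup>2 * (?c * (norm ?u)\<^sup>2)"
    by (intro add_left_mono mult_left_mono mult_right_mono) auto
  also have "\<dots> = - (norm ?u)\<^sup>2 / ?c"
  proof -
    have "- 2 * (1 / c) * s + (1 / c)\<^sup>2 * (c * s) = - s / c" if "c > 0" for c s :: real
      using that by (simp add: power2_eq_square field_simps)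
    then show ?thesis
      using \<open>?c > 0\<close> by blast
  qed
  finally have "(norm ?u)\<^sup>2 \<le> 0"
    using \<open>?c > 0\<close> by (simp add: field_simps)
  then show ?thesis
    by simp
qed

section \<open>Largest eigenvalue and Rayleigh quotient\<close>

lemma qform_max_on_sphere:
  fixes W :: "real^'n^'n"
  obtains v where "norm v = 1" "\<And>x. qform W x \<le> qform W v * (norm x)\<^sup>2"
proof -
  have "axis undefined 1 \<in> sphere (0::real^'n) 1"
    by simp
  then obtain v where v: "v \<in> sphere 0 1" "\<And>x. x \<in> sphere 0 1 \<Longrightarrow> qform W x \<le> qform W v"
    using continuous_attains_sup [OF compact_sphere _ qform_continuous, of 0 1 W] by blast
  have "qform W x \<le> qform W v * (norm x)\<^sup>2" for x
  proof (cases "x = 0")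
    case False
    then have "(norm x)\<^sup>2 * qform W ((1 / norm x) *\<^sub>R x) \<le> (norm x)\<^sup>2 * qform W v"
      by (intro mult_left_mono v(2)) auto
    then show ?thesis
      using False by (simp add: qform_scaleR_right power_divide mult.commute)
  qed (simp add: qform_def)
  then show thesis
    using that v(1) by simp
qed

text \<open>Real eigenvalues embed into the finite complex spectrum; finiteness gives the
  \<open>Max\<close> in \<open>lam_max\<close> its meaning.\<close>

lemma finite_real_eigenvalues:
  "finite {lam. \<exists>v::real^'n. v \<noteq> 0 \<and> W *v v = lam *s v}" (is "finite ?E")
proof -
  have "complex_of_real ` ?E \<subseteq> spectrum (cmat W)"
  proof clarify
    fix lam and v :: "real^'n"
    assume "v \<noteq> 0" "W *v v = lam *s v"
    then have "cmat W *v cvec v = complex_of_real lam *s cvec v"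
      by (simp add: cmat_mult_cvec) (simp add: cvec_def vec_eq_iff)
    moreover have "cvec v \<noteq> 0"
      using \<open>v \<noteq> 0\<close> norm_cvec [of v] by (metis norm_eq_zero)
    ultimately show "complex_of_real lam \<in> spectrum (cmat W)"
      by (rule spectrumI)
  qed
  then have "finite (complex_of_real ` ?E)"
    using finite_spectrum finite_subset by blast
  then show ?thesis
    by (rule finite_imageD) (simp add: inj_on_def)
qed

text \<open>At a maximizer \<open>u\<close> of the form on the unit sphere, the positive
  semidefinite \<open>N\<close> vanishes, so \<open>psd_kernel\<close> makes \<open>u\<close> an
  eigenvector. The maximal value is thus an eigenvalue, at most \<open>lam_max W\<close>.\<close>

lemma lam_max_rayleigh:
  fixes W :: "real^'n^'n"
  assumes sym: "transpose W = W"
  shows "qform W x \<le> lam_max W * (norm x)\<^sup>2"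
    and "\<exists>v. norm v = 1 \<and> lam_max W = qform W v"
proof -
  let ?E = "{lam. \<exists>v::real^'n. v \<noteq> 0 \<and> W *v v = lam *s v}"
  obtain u where u: "norm u = 1" "\<And>x. qform W x \<le> qform W u * (norm x)\<^sup>2"
    using qform_max_on_sphere [of W] by blast
  define N where "N = qform W u *\<^sub>R mat 1 - W"
  have qN: "qform N x = qform W u * (norm x)\<^sup>2 - qform W x" for x
    by (simp add: N_def qform_diff qform_scaleR qform_mat_1)
  have "transpose N = N"
    using sym by (simp add: N_def transpose_def vec_eq_iff mat_def)
  then have "N *v u = 0"
    using psd_kernel [of N u] u by (simp add: qN)
  then have "W *v u = qform W u *s u"
    by (simp add: N_def matrix_vector_mult_diff_rdistrib scaleR_matrix_vector_assoc [symmetric]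
        scalar_mult_eq_scaleR)
  moreover have "u \<noteq> 0"
    using u(1) by auto
  ultimately have uE: "qform W u \<in> ?E"
    by blast
  have le: "qform W u \<le> lam_max W"
    unfolding lam_max_def using uE finite_real_eigenvalues by (rule Max_ge [rotated])
  show "qform W x \<le> lam_max W * (norm x)\<^sup>2"
    using u(2) [of x] mult_right_mono [OF le, of "(norm x)\<^sup>2"] by simp
  have "lam_max W \<in> ?E"
    unfolding lam_max_def using uE finite_real_eigenvalues by (intro Max_in) auto
  then obtain v where v: "v \<noteq> 0" "W *v v = lam_max W *s v"
    by blast
  then have "qform W v = lam_max W * (norm v)\<^sup>2"
    by (simp add: qform_def scalar_mult_eq_scaleR power2_norm_eq_inner)
  then show "\<exists>v. norm v = 1 \<and> lam_max W = qform W v"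
    using v(1) by (intro exI [of _ "(1 / norm v) *\<^sub>R v"])
      (simp add: qform_scaleR_right power_divide)
qed

section \<open>Comparison and unique solvability for the Stein equation\<close>

lemma stein_nonneg:
  assumes stable: "spec_rad A < 1" and dec: "\<And>x. qform D (A *v x) \<le> qform D x"
  shows "0 \<le> qform D x"
proof -
  have "qform D (((*v) A ^^ k) x) \<le> qform D x" for k
    by (induction k) (use dec order_trans in auto)
  moreover have "(\<lambda>k. qform D (((*v) A ^^ k) x)) \<longlonglongrightarrow> qform D 0"
    using qform_continuous [of UNIV D] funpow_mv_tendsto_0 [OF stable, of x]
    by (auto simp: continuous_on_eq_continuous_at intro: isCont_tendsto_compose)
  ultimately show ?thesis
    using LIMSEQ_le_const2 [of _ "qform D 0" "qform D x"] by (auto simp: qform_def)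
qed

text \<open>Turns the decay in one step into a lower bound on the form itself, by discarding the
  nonnegative value at \<open>A x\<close>.\<close>

lemma stein_mono:
  assumes "spec_rad A < 1" and "\<And>x. qform D (A *v x) \<le> qform D x"
  shows "qform D x - qform D (A *v x) \<le> qform D x"
  using stein_nonneg [OF assms, of "A *v x"] by simp

text \<open>In finite dimension it suffices that \<open>L\<close> is injective. For
  \<open>L X = 0\<close> the bilinear form of \<open>X\<close> is constant along pairs of orbits,
  which tend to 0. The bilinear form is used because \<open>X\<close> need not be symmetric.\<close>

lemma stein_ex1:
  assumes stable: "spec_rad A < 1"
  shows "\<exists>!X. transpose A ** X ** A + G = X"
proof -
  define L where "L X = X - transpose A ** X ** A" for X
  have lin: "linear L"
    unfolding L_def
    by (rule linearI)
      (simp_all add: matrix_add_ldistrib matrix_scalar_ac scalar_matrix_assoc [symmetric]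
        scaleR_diff_right matrix_eq matrix_vector_mult_add_rdistrib matrix_vector_mult_diff_rdistrib
        matrix_vector_mul_assoc [symmetric] algebra_simps)
  have "X = 0" if "L X = 0" for X
  proof -
    have eq: "y \<bullet> (X *v x) = (A *v y) \<bullet> (X *v (A *v x))" for x y
    proof -
      have "X = transpose A ** X ** A"
        using that by (simp add: L_def)
      then have "y \<bullet> (X *v x) = y \<bullet> ((transpose A ** X ** A) *v x)"
        by simp
      then show ?thesis
        by (simp add: matrix_vector_mul_assoc [symmetric] inner_vector_matrix)
    qed
    have "y \<bullet> (X *v x) = 0" for x y
    proof -
      let ?s = "\<lambda>k x. ((*v) A ^^ k) x"
      have const: "y \<bullet> (X *v x) = ?s k y \<bullet> (X *v ?s k x)" for k
        by (induction k) (use eq in auto)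
      have "(\<lambda>k. ?s k y \<bullet> (X *v ?s k x)) \<longlonglongrightarrow> 0 \<bullet> (X *v 0)"
        by (intro tendsto_inner funpow_mv_tendsto_0 [OF stable]
            bounded_linear.tendsto [OF matrix_vector_mul_bounded_linear])
      then show ?thesis
        unfolding const [symmetric] by (simp add: LIMSEQ_const_iff)
    qed
    then show ?thesis
      by (metis inner_eq_zero_iff matrix_eq matrix_vector_mult_0)
  qed
  then have "inj L"
    using linear_injective_0 [OF lin] by blast
  then have "surj L"
    using lin linear_injective_imp_surjective by blast
  have "\<exists>!X. L X = G"
    using \<open>inj L\<close> \<open>surj L\<close> by (metis injD surjD)
  moreover have "L X = G \<longleftrightarrow> transpose A ** X ** A + G = X" for X
    by (auto simp: L_def algebra_simps)
  ultimately show ?thesis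
    by simp
qed

section \<open>Lyapunov criteria for stability\<close>

text \<open>The zero matrix is the stable comparison in \<open>spec_rad_lyapunov\<close> when the
  decay is strict away from the origin.\<close>

lemma spec_rad_0: "spec_rad (0 :: real^'n^'n) < 1"
proof -
  have "cmat (0 :: real^'n^'n) = 0"
    by (simp add: cmat_def vec_eq_iff)
  then show ?thesis
    by (auto simp: spec_rad_less_1_iff spectrum_def)
qed

text \<open>Splits a complex eigenvector into real and imaginary parts, so that real quadratic forms
  can be applied to it.\<close>

lemma cmat_eigen_iff:
  fixes A :: "real^'n^'n" and v :: "complex^'n"
  defines "x \<equiv> \<chi> i. Re (v $ i)" and "y \<equiv> \<chi> i. Im (v $ i)"
  shows "cmat A *v v = lam *s v \<longleftrightarrow>
    A *v x = Re lam *\<^sub>R x - Im lam *\<^sub>R y \<and> A *v y = Im lam *\<^sub>R x + Re lam *\<^sub>R y"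
proof -
  have "Re ((cmat A *v v) $ i) = (A *v x) $ i" "Im ((cmat A *v v) $ i) = (A *v y) $ i" for i
    by (simp_all add: cmat_def matrix_vector_mult_def x_def y_def)
  then show ?thesis
    by (auto simp: vec_eq_iff complex_eq_iff x_def y_def algebra_simps)
qed

text \<open>An eigenvector of \<open>A\<close> off the open unit disk must have zero decay, so it is also an
  eigenvector of the stable matrix \<open>A'\<close>.\<close>

lemma spec_rad_lyapunov:
  fixes A A' P :: "real^'n^'n"
  assumes psd: "\<And>x. 0 \<le> qform P x"
    and dec: "\<And>x. qform P (A *v x) \<le> qform P x"
    and eq: "\<And>x. qform P (A *v x) = qform P x \<Longrightarrow> A *v x = A' *v x"
    and stable: "spec_rad A' < 1"
  shows "spec_rad A < 1"
  unfolding spec_rad_less_1_iff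
proof (rule ballI, rule ccontr)
  fix lam
  assume "lam \<in> spectrum (cmat A)" and outside: "\<not> cmod lam < 1"
  then obtain v where v: "v \<noteq> 0" "cmat A *v v = lam *s v"
    by (auto simp: spectrum_def)
  define x y where "x = (\<chi> i. Re (v $ i))" and "y = (\<chi> i. Im (v $ i))"
  define a b where "a = Re lam" and "b = Im lam"
  have Ax: "A *v x = a *\<^sub>R x - b *\<^sub>R y" and Ay: "A *v y = b *\<^sub>R x + a *\<^sub>R y"
    using v(2) unfolding cmat_eigen_iff x_def y_def a_def b_def by auto
  \<comment> \<open>On the pair \<open>x\<close>, \<open>y\<close> the map \<open>A\<close> acts as
    a rotation scaled by \<open>cmod lam\<close>, so the cross terms cancel in the sum.\<close>
  have "qform P (A *v x) + qform P (A *v y) = (a\<^sup>2 + b\<^sup>2) * (qform P x + qform P y)"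
    unfolding Ax Ay qform_def
    by (simp add: matrix_vector_mult_diff_distrib matrix_vector_right_distrib
        matrix_vector_mult_scaleR inner_add_left inner_add_right inner_diff_left inner_diff_right
        power2_eq_square) (simp add: algebra_simps)
  moreover have "1 \<le> a\<^sup>2 + b\<^sup>2"
    using outside one_le_power [of "cmod lam" 2] by (simp add: a_def b_def cmod_power2)
  then have "1 * (qform P x + qform P y) \<le> (a\<^sup>2 + b\<^sup>2) * (qform P x + qform P y)"
    using psd [of x] psd [of y] by (intro mult_right_mono) auto
  ultimately have ge: "qform P x + qform P y \<le> qform P (A *v x) + qform P (A *v y)"
    by simp
  have "qform P (A *v x) = qform P x" "qform P (A *v y) = qform P y"
    using ge dec [of x] dec [of y] by linarith+
  then have "A' *v x = A *v x" "A' *v y = A *v y"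
    using eq by auto
  then have "cmat A' *v v = lam *s v"
    using Ax Ay unfolding cmat_eigen_iff x_def y_def a_def b_def by simp
  then have "lam \<in> spectrum (cmat A')"
    using v(1) by (rule spectrumI)
  then show False
    using stable outside spec_rad_less_1_iff by blast
qed

text \<open>The transpose of \<open>X\<close> solves the same equation, so uniqueness
  applies.\<close>

lemma stein_symmetric:
  assumes "spec_rad A < 1" "transpose G = G" "transpose A ** X ** A + G = X"
  shows "transpose X = X"
proof -
  have "transpose (transpose A ** X ** A + G) = transpose (transpose A ** X ** A) + transpose G"
    by (simp add: transpose_def vec_eq_iff)
  also have "\<dots> = transpose A ** transpose X ** A + transpose G"
    by (simp only: matrix_transpose_mul transpose_transpose matrix_mul_assoc)
  finally have "transpose A ** transpose X ** A + G = transpose X"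
    using assms by simp
  then show ?thesis
    using stein_ex1 [OF assms(1), of G] assms(3) by blast
qed

text \<open>The Lyapunov function for \<open>G = mat 1\<close>: its decay is exactly the squared
  norm, so a bound on a decay by a multiple of the squared norm becomes a bound by the same multiple
  of \<open>P\<close>.\<close>

lemma stein_identity:
  fixes A :: "real^'n^'n"
  assumes stable: "spec_rad A < 1"
  obtains P where "transpose P = P" "\<And>x. qform P x = qform P (A *v x) + (norm x)\<^sup>2"
    "\<And>x. 0 \<le> qform P x"
proof -
  obtain P where P: "transpose A ** P ** A + mat 1 = P"
    using stein_ex1 [OF stable] by blast
  have eq: "qform P x = qform P (A *v x) + (norm x)\<^sup>2" for x
    using qform_add [of "transpose A ** P ** A" "mat 1" x]
    by (simp add: P qform_congruence qform_mat_1)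
  have "qform P (A *v x) \<le> qform P x" for x
    using eq [of x] by simp
  then have "0 \<le> qform P x" for x
    by (rule stein_nonneg [OF stable])
  then show thesis
    using that stein_symmetric [OF stable transpose_mat P] eq by blast
qed

text \<open>The Lyapunov function of \<open>A\<close> still decays strictly under
  \<open>A + t D\<close>, because the perturbation costs only order \<open>t\<close>.\<close>

lemma stable_along_ray:
  fixes A D :: "real^'n^'n"
  assumes stable: "spec_rad A < 1"
  obtains T where "T > 0" "\<And>t. 0 < t \<Longrightarrow> t < T \<Longrightarrow> spec_rad (A + t *\<^sub>R D) < 1"
proof -
  obtain P where sym: "transpose P = P"
    and P: "\<And>x. qform P x = qform P (A *v x) + (norm x)\<^sup>2" and psd: "\<And>x. 0 \<le> qform P x"
    using stein_identity [OF stable] by blast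
  define c e where "c = norm A * (norm P * norm D)" and "e = norm P * (norm D)\<^sup>2"
  have "c \<ge> 0" "e \<ge> 0"
    by (simp_all add: c_def e_def)
  have cross: "(A *v x) \<bullet> (P *v (D *v x)) \<le> c * (norm x)\<^sup>2" for x
  proof -
    have "(A *v x) \<bullet> (P *v (D *v x)) \<le> norm (A *v x) * norm (P *v (D *v x))"
      using Cauchy_Schwarz_ineq2 by (rule order_trans [OF abs_ge_self])
    also have "\<dots> \<le> (norm A * norm x) * (norm P * (norm D * norm x))"
      by (intro mult_mono norm_matrix_vector_le order_trans [OF norm_matrix_vector_le]) auto
    finally show ?thesis
      by (simp add: c_def power2_eq_square mult_ac)
  qed
  have quad: "qform P (D *v x) \<le> e * (norm x)\<^sup>2" for x
  proof -
    have "qform P (D *v x) \<le> norm P * (norm (D *v x))\<^sup>2"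
      by (rule qform_upper)
    also have "\<dots> \<le> norm P * (norm D * norm x)\<^sup>2"
      by (intro mult_left_mono power_mono norm_matrix_vector_le) auto
    finally show ?thesis
      by (simp add: e_def power_mult_distrib mult_ac)
  qed
  \<comment> \<open>Below \<open>T\<close> both \<open>t < 1\<close> and
    \<open>t * (2 * c + e) < 1\<close> hold, which keeps the total perturbation under 1.\<close>
  define T where "T = 1 / (2 * c + e + 1)"
  have "T > 0"
    using \<open>c \<ge> 0\<close> \<open>e \<ge> 0\<close> by (simp add: T_def)
  moreover have "spec_rad (A + t *\<^sub>R D) < 1" if t: "0 < t" "t < T" for t
  proof (rule spec_rad_lyapunov [OF psd _ _ spec_rad_0])
    have t1: "t * (2 * c + e + 1) < 1"
      using t \<open>c \<ge> 0\<close> \<open>e \<ge> 0\<close> by (simp add: T_def field_simps)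
    have "t * (2 * c + e) \<ge> 0"
      using t \<open>c \<ge> 0\<close> \<open>e \<ge> 0\<close> by simp
    then have "t < 1"
      using t1 by (simp add: algebra_simps)
    then have "t\<^sup>2 * e \<le> t * e"
      using t \<open>e \<ge> 0\<close> by (intro mult_right_mono) (auto simp: power2_eq_square mult_left_le)
    then have small: "2 * t * c + t\<^sup>2 * e < 1"
      using t1 t by (simp add: algebra_simps)
    have bound: "qform P ((A + t *\<^sub>R D) *v x)
        \<le> qform P x - (1 - (2 * t * c + t\<^sup>2 * e)) * (norm x)\<^sup>2" for x
    proof -
      have "qform P ((A + t *\<^sub>R D) *v x)
          = qform P (A *v x) + 2 * t * ((A *v x) \<bullet> (P *v (D *v x))) + t\<^sup>2 * qform P (D *v x)"
        using qform_plus [OF sym, of "A *v x" "t *\<^sub>R (D *v x)"]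
        by (simp add: matrix_vector_mult_add_rdistrib scaleR_matrix_vector_assoc [symmetric]
            matrix_vector_mult_scaleR qform_scaleR_right)
      also have "\<dots> \<le> qform P (A *v x) + 2 * t * (c * (norm x)\<^sup>2) + t\<^sup>2 * (e * (norm x)\<^sup>2)"
        using t by (intro add_mono mult_left_mono cross quad) auto
      finally show ?thesis
        using P [of x] by (simp add: algebra_simps)
    qed
    have pos: "(1 - (2 * t * c + t\<^sup>2 * e)) * (norm x)\<^sup>2 \<ge> 0" for x :: "real^'n"
      using small by simp
    show "qform P ((A + t *\<^sub>R D) *v x) \<le> qform P x" for x
      using bound [of x] pos [of x] by linarith
    show "(A + t *\<^sub>R D) *v x = 0 *v x" if "qform P ((A + t *\<^sub>R D) *v x) = qform P x" for x
    proof -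
      have "(1 - (2 * t * c + t\<^sup>2 * e)) * (norm x)\<^sup>2 = 0"
        using bound [of x] pos [of x] that by linarith
      then show ?thesis
        using small by auto
    qed
  qed
  ultimately show thesis
    using that by blast
qed

section \<open>Natural gradient steps for the linear-quadratic regulator\<close>

text \<open>The map \<open>T\<close> is linear, and injective since the \<open>z i\<close> span;
  such a map is bounded below in finite dimension. This converts sums over the \<open>z i\<close>
  into Frobenius norms.\<close>

lemma spanning_bounded_below:
  fixes z :: "'n \<Rightarrow> real^'n"
  assumes "span (range z) = UNIV"
  obtains \<sigma> where "\<sigma> > 0" "\<And>M :: real^'n^'m. \<sigma> * (norm M)\<^sup>2 \<le> (\<Sum>i\<in>UNIV. (norm (M *v z i))\<^sup>2)"
proof -
  define T :: "real^'n^'m \<Rightarrow> real^'m^'n" where "T M = (\<chi> i. M *v z i)" for M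
  have lin: "linear T"
    by (rule linearI)
      (simp_all add: T_def vec_eq_iff matrix_vector_mult_add_rdistrib scaleR_matrix_vector_assoc [symmetric])
  have "M = 0" if "T M = 0" for M :: "real^'n^'m"
  proof -
    have "M *v z i = 0" for i
      using that by (simp add: T_def vec_eq_iff)
    then have "M *v x = 0" for x
      using linear_eq_0_on_span [of "(*v) M" "range z" x] assms by auto
    then show ?thesis
      by (simp add: matrix_eq)
  qed
  then have "inj T"
    using linear_injective_0 [OF lin] by blast
  then obtain b where b: "b > 0" "\<And>M. b * norm M \<le> norm (T M)"
    using linear_inj_bounded_below_pos [OF lin] by blast
  have "b\<^sup>2 * (norm M)\<^sup>2 \<le> (\<Sum>i\<in>UNIV. (norm (M *v z i))\<^sup>2)" for M :: "real^'n^'m"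
  proof -
    have "(b * norm M)\<^sup>2 \<le> (norm (T M))\<^sup>2"
      using b by (intro power_mono) auto
    then show ?thesis
      by (simp add: power_mult_distrib T_def norm_vec_def [of "\<chi> i. M *v z i"] L2_set_def sum_nonneg)
  qed
  then show thesis
    using that [of "b\<^sup>2"] b(1) by simp
qed

section \<open>Value matrices and cost differences of stabilizing gains\<close>

locale lqr =
  fixes A Q :: "real^'n^'n" and B :: "real^'m^'n" and R :: "real^'m^'m"
    and z :: "'n \<Rightarrow> real^'n"
  assumes Qsym: "transpose Q = Q" and Rsym: "transpose R = R"
    and spanning: "span (range z) = UNIV"
begin

abbreviation "cl K \<equiv> A - B ** K"
abbreviation "X K \<equiv> XK A B Q R K"
abbreviation "W K \<equiv> R + transpose B ** X K ** B"
text \<open>Half of \<open>nat_grad\<close>, so the stepsize \<open>1 / (2 * l)\<close> becomes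
  \<open>1 / l\<close>.\<close>

abbreviation "M K \<equiv> R ** K - transpose B ** X K ** cl K"
abbreviation "J K \<equiv> LQR_cost A B Q R z K"

lemma X_eq:
  assumes "K \<in> stab_set A B"
  shows "transpose (cl K) ** X K ** cl K + (Q + transpose K ** R ** K) = X K"
  using theI' [OF stein_ex1 [of "cl K" "Q + transpose K ** R ** K"]] assms
  by (simp add: stab_set_def XK_def add.assoc)

lemma transpose_congruence:
  fixes C :: "real^'k^'l"
  assumes "transpose Y = Y"
  shows "transpose (transpose C ** Y ** C) = transpose C ** Y ** C"
  by (simp only: matrix_transpose_mul transpose_transpose assms matrix_mul_assoc)

lemma X_sym:
  assumes "K \<in> stab_set A B"
  shows "transpose (X K) = X K"
proof (rule stein_symmetric [OF _ _ X_eq [OF assms]])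
  have "transpose (Q + transpose K ** R ** K) = transpose Q + transpose (transpose K ** R ** K)"
    by (simp add: transpose_def vec_eq_iff)
  then show "transpose (Q + transpose K ** R ** K) = Q + transpose K ** R ** K"
    by (simp only: transpose_congruence [OF Rsym] Qsym)
qed (use assms in \<open>simp add: stab_set_def\<close>)

lemma W_sym:
  assumes "K \<in> stab_set A B"
  shows "transpose (W K) = W K"
proof -
  have "transpose (W K) = transpose R + transpose (transpose B ** X K ** B)"
    by (simp add: transpose_def vec_eq_iff)
  then show ?thesis
    by (simp only: transpose_congruence [OF X_sym [OF assms]] Rsym)
qed

lemma qform_X:
  assumes "K \<in> stab_set A B"
  shows "qform (X K) x = qform (X K) (cl K *v x) + qform Q x + qform R (K *v x)"
  using arg_cong [OF X_eq [OF assms], of "\<lambda>Y. qform Y x"]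
  by (simp add: qform_add qform_congruence)

lemma qform_W: "qform (W K) u = qform R u + qform (X K) (B *v u)"
  by (simp add: qform_add qform_congruence)

text \<open>Inequalities between the forms of value matrices pass to the cost by summation.\<close>

lemma J_eq: "J K = (\<Sum>i\<in>UNIV. qform (X K) (z i))"
proof -
  have "J K = (\<Sum>a\<in>UNIV. \<Sum>b\<in>UNIV. \<Sum>i\<in>UNIV. X K $ a $ b * (z i $ b * z i $ a))"
    by (simp add: LQR_cost_def Sigma_mat_def trace_def matrix_matrix_mult_def sum_distrib_left)
  also have "\<dots> = (\<Sum>a\<in>UNIV. \<Sum>i\<in>UNIV. \<Sum>b\<in>UNIV. X K $ a $ b * (z i $ b * z i $ a))"
    by (intro sum.cong refl sum.swap)
  also have "\<dots> = (\<Sum>i\<in>UNIV. \<Sum>a\<in>UNIV. \<Sum>b\<in>UNIV. X K $ a $ b * (z i $ b * z i $ a))"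
    by (rule sum.swap)
  also have "\<dots> = (\<Sum>i\<in>UNIV. qform (X K) (z i))"
    by (simp add: qform_def inner_vec_def matrix_vector_mult_def sum_distrib_left mult_ac)
  finally show ?thesis .
qed

text \<open>The cost of using \<open>K'\<close> for one step and \<open>K\<close> afterwards,
  compared with \<open>K\<close> throughout: the terms linear in \<open>K' - K\<close> collect in
  \<open>M K\<close>, the quadratic ones in \<open>W K\<close>. Stability of \<open>K'\<close> is
  not assumed, so the identity can serve to prove it.\<close>

lemma completion:
  assumes K: "K \<in> stab_set A B"
  shows "qform (X K) (cl K' *v x) + qform Q x + qform R (K' *v x) - qform (X K) x
    = qform (W K) ((K' - K) *v x) + 2 * (((K' - K) *v x) \<bullet> (M K *v x))"
proof -
  define a u d where "a = cl K *v x" and "u = K *v x" and "d = (K' - K) *v x"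
  have 1: "cl K' *v x = a + B *v (- d)"
    by (simp add: a_def d_def matrix_vector_mult_diff_rdistrib matrix_vector_mul_assoc [symmetric]
        matrix_vector_mult_diff_distrib)
  have 2: "K' *v x = u + d"
    by (simp add: u_def d_def matrix_vector_mult_diff_rdistrib)
  have 3: "M K *v x = R *v u - (X K *v a) v* B"
    by (simp add: u_def a_def matrix_vector_mult_diff_rdistrib matrix_vector_mul_assoc [symmetric]
        matrix_vector_mult_diff_distrib vector_matrix_mult_diff_distrib)
  have neg: "B *v (- d) = - (B *v d)"
    using matrix_vector_mult_diff_distrib [of B 0 d] by simp
  have "qform (X K) (a + B *v (- d)) = qform (X K) a - 2 * ((B *v d) \<bullet> (X K *v a)) + qform (X K) (B *v d)"
    using symmetric_inner_commute [OF X_sym [OF K], of a "B *v d"]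
      qform_scaleR_right [of "X K" "- 1" "B *v d"] matrix_vector_mult_diff_distrib [of "X K" 0 "B *v d"]
      qform_plus [OF X_sym [OF K], of a "- (B *v d)"]
    by (simp add: neg)
  moreover have "qform R (u + d) = qform R u + 2 * (d \<bullet> (R *v u)) + qform R d"
    using symmetric_inner_commute [OF Rsym, of u d] by (simp add: qform_plus [OF Rsym])
  moreover have "d \<bullet> (M K *v x) = d \<bullet> (R *v u) - (B *v d) \<bullet> (X K *v a)"
    unfolding 3 by (simp add: inner_diff_right inner_vector_matrix)
  ultimately show ?thesis
    using qform_X [OF K, of x] unfolding d_def [symmetric] 1 2 qform_W a_def [symmetric] u_def [symmetric]
    by simp
qed

lemma X_diff_decay:
  assumes "K \<in> stab_set A B" "K' \<in> stab_set A B"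
  shows "qform (X K' - X K) x - qform (X K' - X K) (cl K' *v x)
    = qform (W K) ((K' - K) *v x) + 2 * (((K' - K) *v x) \<bullet> (M K *v x))"
  using completion [OF assms(1), of K' x] qform_X [OF assms(2), of x] by (simp add: qform_diff)

text \<open>The hypothesis says that \<open>X K' - X K\<close> decays along the closed loop of
  \<open>K'\<close>, so \<open>stein_mono\<close> applies.\<close>

lemma X_diff_ge:
  assumes K: "K \<in> stab_set A B" "K' \<in> stab_set A B"
    and nonneg: "\<And>x. 0 \<le> qform (W K) ((K' - K) *v x) + 2 * (((K' - K) *v x) \<bullet> (M K *v x))"
  shows "qform (W K) ((K' - K) *v x) + 2 * (((K' - K) *v x) \<bullet> (M K *v x))
    \<le> qform (X K') x - qform (X K) x"
proof -
  have "qform (X K' - X K) (cl K' *v x) \<le> qform (X K' - X K) x" for x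
    using X_diff_decay [OF K, of x] nonneg [of x] by linarith
  then show ?thesis
    using stein_mono [of "cl K'" "X K' - X K" x] K(2) X_diff_decay [OF K, of x]
    by (simp add: stab_set_def qform_diff)
qed

lemma X_diff_le:
  assumes K: "K \<in> stab_set A B" "K' \<in> stab_set A B"
    and nonpos: "\<And>x. qform (W K) ((K' - K) *v x) + 2 * (((K' - K) *v x) \<bullet> (M K *v x)) \<le> 0"
  shows "qform (X K') x - qform (X K) x
    \<le> qform (W K) ((K' - K) *v x) + 2 * (((K' - K) *v x) \<bullet> (M K *v x))"
proof -
  have "qform (X K - X K') (cl K' *v x) \<le> qform (X K - X K') x" for x
    using X_diff_decay [OF K, of x] nonpos [of x] by (simp add: qform_diff)
  then show ?thesis
    using stein_mono [of "cl K'" "X K - X K'" x] K(2) X_diff_decay [OF K, of x]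
    by (simp add: stab_set_def qform_diff)
qed

lemma step_eq_gradient_step:
  "K - (1 / (2 * l)) *\<^sub>R nat_grad A B Q R K = K - (1 / l) *\<^sub>R M K"
  by (simp add: nat_grad_def)

end

section \<open>Consequences of strict local minimality\<close>

locale lqr_min = lqr A Q B R z
  for A Q :: "real^'n^'n" and B :: "real^'m^'n" and R :: "real^'m^'m" and z :: "'n \<Rightarrow> real^'n" +
  fixes Ks :: "real^'n^'m" and \<delta> :: real
  assumes Ks_in: "Ks \<in> stab_set A B" and delta_pos: "\<delta> > 0"
    and strict_loc_min: "\<And>K. K \<in> stab_set A B \<Longrightarrow> 0 < norm (K - Ks) \<Longrightarrow> norm (K - Ks) < \<delta> \<Longrightarrow>
        J Ks < J K"
begin

lemma cost_increases_along_ray: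
  assumes "D \<noteq> 0"
  obtains T where "T > 0" "\<And>t. 0 < t \<Longrightarrow> t < T \<Longrightarrow> Ks + t *\<^sub>R D \<in> stab_set A B"
    "\<And>t. 0 < t \<Longrightarrow> t < T \<Longrightarrow> J Ks < J (Ks + t *\<^sub>R D)"
proof -
  have cl: "cl (Ks + t *\<^sub>R D) = cl Ks + t *\<^sub>R (- (B ** D))" for t
    by (simp add: matrix_add_ldistrib matrix_scalar_ac scalar_matrix_assoc [symmetric])
  obtain T where T: "T > 0" "\<And>t. 0 < t \<Longrightarrow> t < T \<Longrightarrow> Ks + t *\<^sub>R D \<in> stab_set A B"
    using stable_along_ray [of "cl Ks" "- (B ** D)"] Ks_in by (auto simp: stab_set_def cl)
  show thesis
  \<comment> \<open>The second bound keeps the perturbed gain within distance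
    \<open>\<delta>\<close> of \<open>Ks\<close>.\<close>
  proof (rule that [of "min T (\<delta> / norm D)"])
    show "J Ks < J (Ks + t *\<^sub>R D)" if "0 < t" "t < min T (\<delta> / norm D)" for t
    proof (rule strict_loc_min)
      show "norm (Ks + t *\<^sub>R D - Ks) < \<delta>"
        using that assms by (simp add: field_simps)
    qed (use that assms T in auto)
  qed (use T assms delta_pos in auto)
qed

text \<open>Otherwise \<open>X_diff_le\<close> would make the value matrix no larger for some small
  \<open>t\<close>, hence also the cost, against strict minimality.\<close>

lemma not_descent_direction:
  assumes "D \<noteq> 0" "T > 0"
  shows "\<exists>t x. 0 < t \<and> t < T \<and> 0 < t\<^sup>2 * qform (W Ks) (D *v x) + 2 * t * ((D *v x) \<bullet> (M Ks *v x))"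
proof (rule ccontr)
  assume contr: "\<not> ?thesis"
  obtain T' where T': "T' > 0" "\<And>t. 0 < t \<Longrightarrow> t < T' \<Longrightarrow> Ks + t *\<^sub>R D \<in> stab_set A B"
    "\<And>t. 0 < t \<Longrightarrow> t < T' \<Longrightarrow> J Ks < J (Ks + t *\<^sub>R D)"
    using cost_increases_along_ray [OF assms(1)] by metis
  obtain t where t: "0 < t" "t < min T T'"
    using dense [of 0 "min T T'"] assms(2) T'(1) by auto
  let ?K = "Ks + t *\<^sub>R D"
  have rhs: "qform (W Ks) ((?K - Ks) *v x) + 2 * (((?K - Ks) *v x) \<bullet> (M Ks *v x)) \<le> 0" for x
  proof -
    have "\<not> 0 < t\<^sup>2 * qform (W Ks) (D *v x) + 2 * t * ((D *v x) \<bullet> (M Ks *v x))"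
      using contr t by (meson min_less_iff_conj)
    then show ?thesis
      by (simp add: scaleR_matrix_vector_assoc [symmetric] qform_scaleR_right)
  qed
  have K: "?K \<in> stab_set A B"
    using T' t by auto
  have "qform (X ?K) x \<le> qform (X Ks) x" for x
    using X_diff_le [OF Ks_in K rhs, of x] rhs [of x] by linarith
  then have "J ?K \<le> J Ks"
    unfolding J_eq by (intro sum_mono)
  then show False
    using T'(3) [of t] t by auto
qed

text \<open>Along \<open>- M Ks\<close> the negative linear term dominates for small
  \<open>t\<close>; \<open>t < 2 / (w + 1)\<close> ensures \<open>t * w \<le> 2\<close>, which is
  small enough.\<close>

lemma M_Ks: "M Ks = 0"
proof (rule ccontr)
  assume "M Ks \<noteq> 0"
  define w where "w = norm (W Ks)"
  have "w \<ge> 0"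
    by (simp add: w_def)
  obtain t x where t: "0 < t" "t < 2 / (w + 1)"
    and pos: "0 < t\<^sup>2 * qform (W Ks) (- M Ks *v x) + 2 * t * ((- M Ks *v x) \<bullet> (M Ks *v x))"
    using not_descent_direction [of "- M Ks" "2 / (w + 1)"] \<open>M Ks \<noteq> 0\<close> \<open>w \<ge> 0\<close> by auto
  define y where "y = M Ks *v x"
  have y: "- M Ks *v x = - y"
    using matrix_vector_mult_diff_rdistrib [of 0 "M Ks" x] by (simp add: y_def)
  have "0 < t\<^sup>2 * qform (W Ks) y - 2 * t * (norm y)\<^sup>2"
    using pos qform_scaleR_right [of "W Ks" "- 1" y] unfolding y y_def [symmetric]
    by (simp add: power2_norm_eq_inner)
  also have "\<dots> \<le> t\<^sup>2 * (w * (norm y)\<^sup>2) - 2 * t * (norm y)\<^sup>2"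
    unfolding w_def by (intro diff_right_mono mult_left_mono qform_upper) auto
  also have "\<dots> = t * (norm y)\<^sup>2 * (t * w - 2)"
    by (simp add: power2_eq_square algebra_simps)
  also have "\<dots> \<le> 0"
    using t \<open>w \<ge> 0\<close> by (intro mult_nonneg_nonpos) (auto simp: field_simps)
  finally show False
    by simp
qed

text \<open>Since \<open>M Ks = 0\<close>, only the quadratic term is left. It is tested at a unit
  vector \<open>v\<close> minimizing the form of \<open>W Ks\<close>.\<close>

lemma W_Ks_pos: "\<exists>\<mu>>0. \<forall>u. \<mu> * (norm u)\<^sup>2 \<le> qform (W Ks) u"
proof -
  obtain v where v: "norm v = 1" "\<And>x. qform (- W Ks) x \<le> qform (- W Ks) v * (norm x)\<^sup>2"
    using qform_max_on_sphere [of "- W Ks"] by blast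
  \<comment> \<open>A rank-one direction with range spanned by \<open>v\<close>;
    \<open>undefined\<close> is merely some coordinate.\<close>
  define D :: "real^'n^'m" where "D = (\<chi> i j. v $ i * axis undefined 1 $ j)"
  have D: "D *v x = (x $ undefined) *\<^sub>R v" for x
    by (simp add: D_def vec_eq_iff matrix_vector_mult_def axis_def if_distrib if_distribR cong: if_cong)
  have "D \<noteq> 0"
  proof
    assume "D = 0"
    then show False
      using D [of "axis undefined 1"] v(1) by simp
  qed
  then have "\<exists>t x. 0 < t \<and> 0 < t\<^sup>2 * qform (W Ks) (D *v x)"
    using not_descent_direction [of D 1] by (auto simp: M_Ks)
  then have "0 < qform (W Ks) v"
    by (auto simp: D qform_scaleR_right zero_less_mult_iff not_less [symmetric])
  moreover have "qform (W Ks) v * (norm u)\<^sup>2 \<le> qform (W Ks) u" for u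
    using v(2) [of u] by (simp only: qform_minus)
  ultimately show ?thesis
    by blast
qed

definition "\<mu> = (SOME \<mu>. \<mu> > 0 \<and> (\<forall>u. \<mu> * (norm u)\<^sup>2 \<le> qform (W Ks) u))"

lemma mu_pos: "\<mu> > 0" and mu_le: "\<mu> * (norm u)\<^sup>2 \<le> qform (W Ks) u"
  using someI_ex [OF W_Ks_pos, folded \<mu>_def] by auto

text \<open>As \<open>M Ks = 0\<close>, the decay of \<open>X K - X Ks\<close> is purely the form of
  \<open>W Ks\<close>. Summed over the \<open>z i\<close>, this gives global minimality of
  \<open>Ks\<close> and quadratic growth.\<close>

lemma X_growth:
  assumes "K \<in> stab_set A B"
  shows "\<mu> * (norm ((K - Ks) *v x))\<^sup>2 \<le> qform (X K) x - qform (X Ks) x"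
proof -
  have nonneg: "0 \<le> qform (W Ks) u" for u
    using mu_le [of u] mu_pos by (meson less_imp_le mult_nonneg_nonneg order_trans zero_le_power2)
  show ?thesis
    using X_diff_ge [OF Ks_in assms, of x] mu_le [of "(K - Ks) *v x"] nonneg by (simp add: M_Ks)
qed

lemma X_Ks_le:
  assumes "K \<in> stab_set A B"
  shows "qform (X Ks) x \<le> qform (X K) x"
  using X_growth [OF assms, of x] mu_pos by (smt (verit) mult_nonneg_nonneg zero_le_power2)

text \<open>\<open>W K\<close> is monotone in \<open>X K\<close>, so the bound at \<open>Ks\<close>
  holds uniformly over all stabilizing gains.\<close>

lemma mu_le_W:
  assumes "K \<in> stab_set A B"
  shows "\<mu> * (norm u)\<^sup>2 \<le> qform (W K) u"
  using mu_le [of u] X_Ks_le [OF assms, of "B *v u"] by (simp only: qform_W)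

lemma mu_le_lam_max:
  assumes "K \<in> stab_set A B"
  shows "\<mu> \<le> lam_max (W K)"
proof -
  obtain v where "norm v = 1" "lam_max (W K) = qform (W K) v"
    using lam_max_rayleigh(2) [OF W_sym [OF assms]] by blast
  then show ?thesis
    using mu_le_W [OF assms, of v] by simp
qed

section \<open>Descent, gradient domination and the linear rate\<close>

lemma gradient_step:
  assumes K: "K \<in> stab_set A B" and K': "K' = K - (1 / lam_max (W K)) *\<^sub>R M K"
  shows "K' \<in> stab_set A B"
    and "(norm (M K *v x))\<^sup>2 / lam_max (W K) \<le> qform (X K) x - qform (X K') x"
proof -
  define l where "l = lam_max (W K)"
  have "l > 0"
    using mu_pos mu_le_lam_max [OF K] by (simp add: l_def)
  have diff: "(K' - K) *v x = (- (1 / l)) *\<^sub>R (M K *v x)" for x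
    using scaleR_matrix_vector_assoc [of "- (1 / l)" "M K" x] by (simp add: K' l_def)
  \<comment> \<open>With \<open>l\<close> the largest eigenvalue of \<open>W K\<close>, the
    quadratic term is at most half the linear one in size.\<close>
  have decrease: "qform (W K) ((K' - K) *v x) + 2 * (((K' - K) *v x) \<bullet> (M K *v x))
      \<le> - ((norm (M K *v x))\<^sup>2 / l)" for x
  proof -
    define y where "y = M K *v x"
    have "qform (W K) ((K' - K) *v x) + 2 * (((K' - K) *v x) \<bullet> (M K *v x))
        = qform (W K) y / l\<^sup>2 - 2 * (norm y)\<^sup>2 / l"
      unfolding diff qform_scaleR_right y_def [symmetric] inner_scaleR_left power2_norm_eq_inner
      by (simp add: power_divide)
    also have "\<dots> \<le> l * (norm y)\<^sup>2 / l\<^sup>2 - 2 * (norm y)\<^sup>2 / l"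
      unfolding l_def by (intro diff_right_mono divide_right_mono lam_max_rayleigh W_sym K) auto
    also have "\<dots> = - ((norm y)\<^sup>2 / l)"
      using \<open>l > 0\<close> by (simp add: power2_eq_square field_simps)
    finally show ?thesis
      by (simp only: y_def)
  qed
  have nonneg: "0 \<le> (norm (M K *v x))\<^sup>2 / l" for x
    using \<open>l > 0\<close> by simp
  let ?P = "X K - X Ks"
  \<comment> \<open>Subtract the \<open>completion\<close> identities based at \<open>K\<close> and
    at \<open>Ks\<close> with the same \<open>K'\<close>; the terms in \<open>Q\<close> and
    \<open>R\<close> cancel.\<close>
  have decay: "qform ?P (cl K' *v x) \<le> qform ?P x - \<mu> * (norm ((K' - Ks) *v x))\<^sup>2" for x
    using completion [OF K, of K' x] completion [OF Ks_in, of K' x] decrease [of x] nonneg [of x]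
      mu_le [of "(K' - Ks) *v x"]
    by (simp add: M_Ks qform_diff)
  have gap: "0 \<le> \<mu> * (norm ((K' - Ks) *v x))\<^sup>2" for x
    using mu_pos by simp
  show K'S: "K' \<in> stab_set A B"
    unfolding stab_set_def mem_Collect_eq
  proof (rule spec_rad_lyapunov [of ?P])
    show "0 \<le> qform ?P x" for x
      using X_Ks_le [OF K, of x] by (simp add: qform_diff)
    show "qform ?P (cl K' *v x) \<le> qform ?P x" for x
      using decay [of x] gap [of x] by linarith
    show "cl K' *v x = cl Ks *v x" if "qform ?P (cl K' *v x) = qform ?P x" for x
    proof -
      have "\<mu> * (norm ((K' - Ks) *v x))\<^sup>2 = 0"
        using decay [of x] gap [of x] that by linarith
      then have "K' *v x = Ks *v x"
        using mu_pos by (simp add: matrix_vector_mult_diff_rdistrib)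
      then show ?thesis
        by (simp add: matrix_vector_mult_diff_rdistrib matrix_vector_mul_assoc [symmetric])
    qed
  qed (use Ks_in in \<open>simp add: stab_set_def\<close>)
  have "qform (W K) ((K' - K) *v x) + 2 * (((K' - K) *v x) \<bullet> (M K *v x)) \<le> 0" for x
    using decrease [of x] nonneg [of x] by linarith
  from X_diff_le [OF K K'S this, of x] decrease [of x]
  show "(norm (M K *v x))\<^sup>2 / lam_max (W K) \<le> qform (X K) x - qform (X K') x"
    by (simp add: l_def)
qed

text \<open>Completing the square bounds the decay of \<open>X Ks - X K\<close> below by \<open>- \<parallel>M K x\<parallel>\<^sup>2 / \<mu>\<close> along the
  optimal closed loop, which the solution of the Stein equation at \<open>Ks\<close> turns into an upper bound.\<close>

lemma gradient_domination:
  obtains p where "p \<ge> 0"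
    "\<And>K. K \<in> stab_set A B \<Longrightarrow> J K - J Ks \<le> (norm (M K))\<^sup>2 / \<mu> * p"
proof -
  have stable: "spec_rad (cl Ks) < 1"
    using Ks_in by (simp add: stab_set_def)
  obtain P where "transpose P = P" and P: "\<And>x. qform P x = qform P (cl Ks *v x) + (norm x)\<^sup>2" "\<And>x. 0 \<le> qform P x"
    using stein_identity [OF stable] by blast
  show thesis
  proof (rule that [of "\<Sum>i\<in>UNIV. qform P (z i)"])
    fix K
    assume K: "K \<in> stab_set A B"
    define c where "c = (norm (M K))\<^sup>2 / \<mu>"
    have lower: "- (c * (norm x)\<^sup>2) \<le> qform (X Ks - X K) x - qform (X Ks - X K) (cl Ks *v x)" for x
    proof -
      define d y where "d = (Ks - K) *v x" and "y = M K *v x"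
      have "0 \<le> (norm (\<mu> *\<^sub>R d + y))\<^sup>2 / \<mu>"
        using mu_pos by simp
      also have "\<dots> = \<mu> * (norm d)\<^sup>2 + 2 * (d \<bullet> y) + (norm y)\<^sup>2 / \<mu>"
        using mu_pos unfolding power2_norm_eq_inner
        by (simp add: inner_add_left inner_add_right inner_commute add_divide_distrib)
      also have "(norm y)\<^sup>2 / \<mu> \<le> c * (norm x)\<^sup>2"
        using mu_pos power_mono [OF norm_matrix_vector_le [of "M K" x], of 2]
        by (simp add: c_def y_def power_mult_distrib divide_right_mono)
      also have "\<mu> * (norm d)\<^sup>2 \<le> qform (W K) d"
        by (rule mu_le_W [OF K])
      finally show ?thesis
        using X_diff_decay [OF K Ks_in, of x] by (simp add: d_def y_def)
    qed
    \<comment> \<open>The decay of \<open>c\<close> times \<open>P\<close> exactly offsets the lower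
      bound, so \<open>?E\<close> has nonnegative decay.\<close>
    let ?E = "(X Ks - X K) + c *\<^sub>R P"
    have E: "0 \<le> qform ?E x" for x
    proof (rule stein_nonneg [OF stable])
      show "qform ?E (cl Ks *v x) \<le> qform ?E x" for x
        using lower [of x] P(1) [of x] by (simp only: qform_add [of _ "c *\<^sub>R P"] qform_scaleR)
          (simp add: algebra_simps)
    qed
    have "qform (X K) x - qform (X Ks) x \<le> c * qform P x" for x
      using E [of x] by (simp add: qform_add qform_diff qform_scaleR)
    then show "J K - J Ks \<le> c * (\<Sum>i\<in>UNIV. qform P (z i))"
      unfolding J_eq by (simp add: sum_subtractf [symmetric] sum_distrib_left sum_mono)
  qed (use P(2) in \<open>simp add: sum_nonneg\<close>)
qed

text \<open>The linear term vanishes at \<open>Ks\<close>, so the decay of \<open>X K - X Ks\<close>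
  is quadratic in \<open>K - Ks\<close>. The constant may depend on \<open>K\<close>, since the
  bound is applied only to the initial gain.\<close>

lemma cost_upper:
  assumes K: "K \<in> stab_set A B"
  obtains C where "C > 0" "J K - J Ks \<le> C * (norm (K - Ks))\<^sup>2"
proof -
  have stable: "spec_rad (cl K) < 1"
    using K by (simp add: stab_set_def)
  obtain P where "transpose P = P" and P: "\<And>x. qform P x = qform P (cl K *v x) + (norm x)\<^sup>2" "\<And>x. 0 \<le> qform P x"
    using stein_identity [OF stable] by blast
  define c where "c = norm (W Ks) * (norm (K - Ks))\<^sup>2"
  have upper: "qform (X K - X Ks) x - qform (X K - X Ks) (cl K *v x) \<le> c * (norm x)\<^sup>2" for x
  proof -
    have "qform (X K - X Ks) x - qform (X K - X Ks) (cl K *v x) = qform (W Ks) ((K - Ks) *v x)"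
      using X_diff_decay [OF Ks_in K, of x] by (simp add: M_Ks)
    also have "\<dots> \<le> norm (W Ks) * (norm ((K - Ks) *v x))\<^sup>2"
      by (rule qform_upper)
    also have "\<dots> \<le> norm (W Ks) * (norm (K - Ks) * norm x)\<^sup>2"
      by (intro mult_left_mono power_mono norm_matrix_vector_le) auto
    finally show ?thesis
      by (simp add: c_def power_mult_distrib mult_ac)
  qed
  let ?E = "c *\<^sub>R P - (X K - X Ks)"
  have E: "0 \<le> qform ?E x" for x
  proof (rule stein_nonneg [OF stable])
    show "qform ?E (cl K *v x) \<le> qform ?E x" for x
      using upper [of x] P(1) [of x] by (simp only: qform_diff [of "c *\<^sub>R P"] qform_scaleR)
        (simp add: algebra_simps)
  qed
  have le: "qform (X K) x - qform (X Ks) x \<le> c * qform P x" for x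
    using E [of x] by (simp add: qform_diff qform_scaleR)
  define p where "p = (\<Sum>i\<in>UNIV. qform P (z i))"
  have "p \<ge> 0"
    using P(2) by (simp add: p_def sum_nonneg)
  have "J K - J Ks \<le> c * p"
    unfolding J_eq p_def by (simp add: sum_subtractf [symmetric] sum_distrib_left sum_mono le)
  \<comment> \<open>The \<open>1\<close> makes the constant strictly positive.\<close>
  also have "\<dots> \<le> (norm (W Ks) * p + 1) * (norm (K - Ks))\<^sup>2"
    by (simp add: c_def algebra_simps)
  finally show thesis
    using that [of "norm (W Ks) * p + 1"] \<open>p \<ge> 0\<close> by (simp add: add_nonneg_pos)
qed

theorem natural_gradient_linear_convergence:
  assumes K0: "Kseq 0 \<in> stab_set A B"
    and step: "\<And>j. Kseq (Suc j) = Kseq j - (1 / lam_max (W (Kseq j))) *\<^sub>R M (Kseq j)"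
  shows "Kseq j \<in> stab_set A B"
    and "\<exists>q c. 0 < q \<and> q < 1 \<and> c > 0 \<and>
      (\<forall>j. J (Kseq j) - J Ks \<le> q ^ j * (J (Kseq 0) - J Ks)
         \<and> (norm (Kseq j - Ks))\<^sup>2 \<le> c * q ^ j * (norm (Kseq 0 - Ks))\<^sup>2)"
proof -
  show stab: "Kseq j \<in> stab_set A B" for j
    by (induction j) (use K0 gradient_step(1) [OF _ step] in auto)
  define l where "l j = lam_max (W (Kseq j))" for j
  have l_pos: "l j > 0" for j
    using mu_pos mu_le_lam_max [OF stab [of j]] by (simp add: l_def)
  have drop: "(norm (M (Kseq j) *v x))\<^sup>2 / l j \<le> qform (X (Kseq j)) x - qform (X (Kseq (Suc j))) x"
    for j x
    unfolding l_def by (rule gradient_step(2) [OF stab step])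
  have X_mono: "qform (X (Kseq j)) x \<le> qform (X (Kseq 0)) x" for j x
  proof (induction j)
    case (Suc j)
    have "0 \<le> (norm (M (Kseq j) *v x))\<^sup>2 / l j"
      using l_pos [of j] by simp
    then show ?case
      using Suc drop [of j x] by linarith
  qed simp
  \<comment> \<open>Value matrices decrease along the iteration, hence so does \<open>W\<close>; the
    stepsizes never fall below the first one.\<close>
  have l_le: "l j \<le> l 0" for j
  proof -
    obtain v where v: "norm v = 1" "l j = qform (W (Kseq j)) v"
      using lam_max_rayleigh(2) [OF W_sym [OF stab [of j]]] by (auto simp: l_def)
    have "l j \<le> qform (W (Kseq 0)) v"
      unfolding v(2) qform_W using X_mono by simp
    also have "\<dots> \<le> l 0"
      using lam_max_rayleigh(1) [OF W_sym [OF stab [of 0]], of v] v(1) by (simp add: l_def)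
    finally show ?thesis .
  qed
  obtain \<sigma> where \<sigma>: "\<sigma> > 0" "\<And>M :: real^'n^'m. \<sigma> * (norm M)\<^sup>2 \<le> (\<Sum>i\<in>UNIV. (norm (M *v z i))\<^sup>2)"
    using spanning_bounded_below [OF spanning] by blast
  obtain p where p: "p \<ge> 0"
    "\<And>K. K \<in> stab_set A B \<Longrightarrow> J K - J Ks \<le> (norm (M K))\<^sup>2 / \<mu> * p"
    using gradient_domination by blast
  obtain C where C: "C > 0" "J (Kseq 0) - J Ks \<le> C * (norm (Kseq 0 - Ks))\<^sup>2"
    using cost_upper [OF stab] by blast
  \<comment> \<open>Chosen so that gradient domination times \<open>r / p'\<close> yields exactly
    the guaranteed decrease per step.\<close>
  define r where "r = \<sigma> * \<mu> / l 0"
  have r: "r > 0"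
    using \<sigma>(1) mu_pos l_pos by (simp add: r_def)
  \<comment> \<open>Enlarging \<open>p\<close> beyond \<open>r\<close> puts \<open>q\<close>
    strictly between 0 and 1, even if \<open>p = 0\<close>.\<close>
  define p' where "p' = p + 1 + r"
  have p': "p' > 0" "p \<le> p'" "r < p'"
    using r p(1) by (auto simp: p'_def)
  define q where "q = 1 - r / p'"
  have q: "0 < q" "q < 1"
    using r p' by (auto simp: q_def)
  define e where "e j = J (Kseq j) - J Ks" for j
  have grad_sum: "\<sigma> * (norm (M (Kseq j)))\<^sup>2 / l 0 \<le> e j - e (Suc j)" for j
  proof -
    have "\<sigma> * (norm (M (Kseq j)))\<^sup>2 / l 0 \<le> (\<Sum>i\<in>UNIV. (norm (M (Kseq j) *v z i))\<^sup>2) / l 0"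
      using \<sigma>(2) l_pos [of 0] by (intro divide_right_mono) auto
    also have "\<dots> \<le> (\<Sum>i\<in>UNIV. (norm (M (Kseq j) *v z i))\<^sup>2) / l j"
      using l_le l_pos by (intro divide_left_mono) (auto simp: sum_nonneg)
    also have "\<dots> \<le> (\<Sum>i\<in>UNIV. qform (X (Kseq j)) (z i) - qform (X (Kseq (Suc j))) (z i))"
      unfolding sum_divide_distrib by (intro sum_mono drop)
    finally show ?thesis
      by (simp add: e_def J_eq sum_subtractf)
  qed
  have contract: "e (Suc j) \<le> q * e j" for j
  proof -
    define g where "g = (norm (M (Kseq j)))\<^sup>2"
    have "e j \<le> g / \<mu> * p"
      unfolding e_def g_def using p(2) [OF stab] .
    also have "\<dots> \<le> g / \<mu> * p'"
      using mu_pos p' by (intro mult_left_mono) (auto simp: g_def)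
    finally have "e j * (r / p') \<le> (g / \<mu> * p') * (r / p')"
      using r p'(1) by (intro mult_right_mono) auto
    also have "\<dots> = \<sigma> * g / l 0"
      using mu_pos p'(1) by (simp add: r_def)
    finally show ?thesis
      using grad_sum [of j] by (simp add: g_def q_def algebra_simps)
  qed
  have cost: "e j \<le> q ^ j * e 0" for j
  proof (induction j)
    case (Suc j)
    have "q * e j \<le> q * (q ^ j * e 0)"
      using Suc q by (intro mult_left_mono) auto
    then show ?case
      using contract [of j] by (simp add: mult_ac)
  qed simp
  have gain: "(norm (Kseq j - Ks))\<^sup>2 \<le> C / (\<sigma> * \<mu>) * q ^ j * (norm (Kseq 0 - Ks))\<^sup>2" for j
  proof -
    \<comment> \<open>Quadratic growth at iterate \<open>j\<close>, the cost rate, then the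
      quadratic upper bound at the initial gain.\<close>
    have "\<mu> * (\<sigma> * (norm (Kseq j - Ks))\<^sup>2) \<le> \<mu> * (\<Sum>i\<in>UNIV. (norm ((Kseq j - Ks) *v z i))\<^sup>2)"
      using \<sigma>(2) mu_pos by (intro mult_left_mono) auto
    also have "\<dots> \<le> e j"
      unfolding e_def J_eq sum_distrib_left sum_subtractf [symmetric]
      by (intro sum_mono X_growth stab)
    also have "\<dots> \<le> q ^ j * e 0"
      by (rule cost)
    also have "\<dots> \<le> q ^ j * (C * (norm (Kseq 0 - Ks))\<^sup>2)"
      using C(2) q by (intro mult_left_mono) (auto simp: e_def)
    finally show ?thesis
      using mu_pos \<sigma>(1) by (simp add: field_simps)
  qed
  show "\<exists>q c. 0 < q \<and> q < 1 \<and> c > 0 \<and>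
      (\<forall>j. J (Kseq j) - J Ks \<le> q ^ j * (J (Kseq 0) - J Ks)
         \<and> (norm (Kseq j - Ks))\<^sup>2 \<le> c * q ^ j * (norm (Kseq 0 - Ks))\<^sup>2)"
    using q C(1) \<sigma>(1) mu_pos cost gain unfolding e_def
    by (intro exI [of _ q] exI [of _ "C / (\<sigma> * \<mu>)"]) simp
qed

end

theorem theorem1:
  fixes A Q :: "real^'n^'n" and B :: "real^'m^'n" and R :: "real^'m^'m"
    and z :: "'n \<Rightarrow> real^'n"
    and Ks K0 :: "real^'n^'m" and Kseq :: "nat \<Rightarrow> real^'n^'m" and \<delta> :: real
  assumes stabilizable: "stab_set A B \<noteq> {}"
    and Qsym: "transpose Q = Q" and Rsym: "transpose R = R"
    and spanning: "span (range z) = UNIV"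
    and Ks_in: "Ks \<in> stab_set A B" and delta_pos: "\<delta> > 0"
    and strict_loc_min: "\<And>K. K \<in> stab_set A B \<Longrightarrow> 0 < frob (K - Ks) \<Longrightarrow> frob (K - Ks) < \<delta> \<Longrightarrow>
        LQR_cost A B Q R z Ks < LQR_cost A B Q R z K"
    and K0_in: "K0 \<in> stab_set A B"
    and init: "Kseq 0 = K0"
    and step: "\<And>j. Kseq (Suc j) = Kseq j -
        (1 / (2 * lam_max (R + transpose B ** XK A B Q R (Kseq j) ** B))) *\<^sub>R nat_grad A B Q R (Kseq j)"
  shows "(\<forall>j. Kseq j \<in> stab_set A B) \<and>
    (\<exists>q1 c1. 0 < q1 \<and> q1 < 1 \<and> c1 > 0 \<and>
      (\<forall>j. LQR_cost A B Q R z (Kseq j) - LQR_cost A B Q R z Ks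
              \<le> q1 ^ j * (LQR_cost A B Q R z K0 - LQR_cost A B Q R z Ks)
         \<and> (frob (Kseq j - Ks))^2 \<le> c1 * q1 ^ j * (frob (K0 - Ks))^2))"
proof -
  interpret lqr_min A Q B R z Ks \<delta>
    using Qsym Rsym spanning Ks_in delta_pos strict_loc_min
    by unfold_locales (auto simp: frob_eq_norm)
  have "Kseq 0 \<in> stab_set A B"
    using K0_in init by simp
  moreover have "Kseq (Suc j) = Kseq j - (1 / lam_max (W (Kseq j))) *\<^sub>R M (Kseq j)" for j
    using step [of j] by (simp only: step_eq_gradient_step)
  ultimately show ?thesis
    using natural_gradient_linear_convergence [of Kseq] unfolding frob_eq_norm init by blast
qed

end
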